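(* Let $m,n$ be positive integers and let $(a_{ij})\in\mathbb{R}^{m\times n}$ be any given matrix. Then there exists a unique polynomial $P\in\mathcal{P}_m^n$ such that $P(i,j)=a_{ij}$ for all $i=1,2,\ldots,m$ and $j=1,2,\ldots,n$.
   Context: For positive integers $m,n$, $\mathcal{P}_m^n$ denotes the real vector space of polynomials in two variables $x,y$ of the form $P(x,y)=\sum_{k_1=0}^{m-1}\sum_{k_2=0}^{n-1}\lambda_{k_1,k_2}x^{k_1}y^{k_2}$ with $\lambda_{k_1,k_2}\in\mathbb{R}$. *)

theory Defs
  imports Complex_Main "HOL-Computational_Algebra.Polynomial"
begin

text \<open>
  A polynomial in the variables \<open>x\<close>, \<open>y\<close> is an element of \<^typ>\<open>real poly poly\<close>, i.e. a polynomial
  in \<open>x\<close> with coefficients in \<open>\<real>[y]\<close>. The monomial \<open>c x^k1 y^k2\<close> is thus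
  \<^term>\<open>monom (monom c k2) k1\<close>, and substituting the constant \<open>[:x:]\<close> for the outer variable leaves a
  polynomial in \<open>y\<close>.
\<close>

definition poly_xy :: "real poly poly \<Rightarrow> real \<Rightarrow> real \<Rightarrow> real" where
  "poly_xy P x y = poly (poly P [:x:]) y"

definition poly_space :: "nat \<Rightarrow> nat \<Rightarrow> real poly poly set" where
  "poly_space m n =
     {\<Sum>k1<m. \<Sum>k2<n. monom (monom (l k1 k2) k2) k1 | l :: nat \<Rightarrow> nat \<Rightarrow> real. True}"

lemma poly_xy_sum_monom:
  "poly_xy (\<Sum>k1<m. \<Sum>k2<n. monom (monom (l k1 k2) k2) k1) x y =
     (\<Sum>k1<m. \<Sum>k2<n. l k1 k2 * x ^ k1 * y ^ k2)"
  by (simp add: poly_xy_def poly_sum poly_monom poly_power mult.commute mult.left_commute)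

end

theory Submission
  imports Defs
begin

text \<open>
  Substituting \<open>x = i\<close> and \<open>y = j\<close> into a polynomial of the given shape composes two univariate
  evaluations, so the bivariate problem is the tensor product of two univariate interpolation
  problems, on the \<open>m\<close> nodes \<open>1, \<dots>, m\<close> and on the \<open>n\<close> nodes \<open>1, \<dots>, n\<close>. Only the
  number of nodes in each direction matters.

  Existence: univariate cardinal functions \<open>L\<^sub>u\<close> (one at the node \<open>u\<close>, zero at the other nodes; see
  \<open>lagrange_cardinal_coeffs\<close>) multiply to bivariate ones, and \<open>\<Sum> a u v L\<^sub>u(x) L\<^sub>v(y)\<close> takes the
  prescribed values (\<open>grid_interpolation_exists\<close>).

  Uniqueness: if the interpolant of zero data is frozen at a node \<open>y\<close>, a univariate polynomial in
  \<open>x\<close> with too many roots remains. Hence each of its coefficients, which is a polynomial in \<open>y\<close>,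
  vanishes at every node \<open>y\<close>, and therefore vanishes too (\<open>grid_values_zero_imp_coeffs_zero\<close>).
\<close>

text \<open>
  This is the injectivity of the Vandermonde matrix: a nonzero polynomial of degree below
  \<open>card S\<close> cannot have all of \<open>S\<close> among its roots.
\<close>
lemma power_sum_zero_imp_coeffs_zero:
  fixes c :: "nat \<Rightarrow> 'a::field" and S :: "'a set"
  assumes zero: "\<And>x. x \<in> S \<Longrightarrow> (\<Sum>k<card S. c k * x ^ k) = 0"
    and k: "k < card S"
  shows "c k = 0"
proof -
  define p where "p = (\<Sum>k<card S. monom (c k) k)"
  have coeff_p: "coeff p i = (if i < card S then c i else 0)" for i
    by (simp add: p_def coeff_sum)
  have "p = 0"
  proof (rule ccontr)
    assume nz: "p \<noteq> 0"
    have "degree p < card S"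
      using nz coeff_p[of "degree p"] by (simp split: if_splits)
    moreover have "S \<subseteq> {x. poly p x = 0}"
      using zero by (auto simp: p_def poly_sum poly_monom)
    then have "card S \<le> card {x. poly p x = 0}"
      using nz by (intro card_mono poly_roots_finite)
    moreover have "card {x. poly p x = 0} \<le> degree p"
      using nz by (rule card_poly_roots_bound)
    ultimately show False by simp
  qed
  then show ?thesis using coeff_p[of k] k by simp
qed

text \<open>
  The coefficients \<open>c u\<close> are those of the Lagrange polynomial
  \<open>\<Prod>s \<in> S - {u}. (x - s) / (u - s)\<close>, whose degree is \<open>card S - 1\<close>.
\<close>
lemma lagrange_cardinal_coeffs:
  fixes S :: "'a::field set"
  assumes fin: "finite S"
  obtains c :: "'a \<Rightarrow> nat \<Rightarrow> 'a" where
    "\<And>u x. u \<in> S \<Longrightarrow> x \<in> S \<Longrightarrow> (\<Sum>k<card S. c u k * x ^ k) = (if x = u then 1 else 0)"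
proof
  define q :: "'a \<Rightarrow> 'a poly" where "q u = (\<Prod>s\<in>S - {u}. [:- s, 1:])" for u
  define L where "L u = smult (inverse (poly (q u) u)) (q u)" for u
  fix u x assume u: "u \<in> S" and x: "x \<in> S"
  have "degree (q u) = card (S - {u})"
    unfolding q_def by (subst degree_prod_eq_sum_degree) auto
  also have "\<dots> < card S"
    using fin u by (rule card_Diff1_less)
  finally have deg: "degree (L u) < card S"
    by (simp add: L_def)
  have nonzero: "poly (q u) u \<noteq> 0"
    using fin by (simp add: q_def poly_prod)
  have vanish: "poly (q u) x = 0" if "x \<noteq> u"
    using fin x that by (auto simp: q_def poly_prod)
  have "(\<Sum>k<card S. coeff (L u) k * x ^ k) = poly (L u) x"
    unfolding poly_altdef
    by (rule sum.mono_neutral_right) (use deg in \<open>auto simp: coeff_eq_0\<close>)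
  also have "\<dots> = (if x = u then 1 else 0)"
    using nonzero vanish by (simp add: L_def)
  finally show "(\<Sum>k<card S. coeff (L u) k * x ^ k) = (if x = u then 1 else 0)" .
qed

text \<open>
  The coefficient matrix of the interpolant is a combination of the rank-one matrices
  \<open>b u k1 * c v k2\<close>, which represent the products of cardinal functions.
\<close>
lemma grid_interpolation_exists:
  fixes S T :: "'a::field set" and a :: "'a \<Rightarrow> 'a \<Rightarrow> 'a"
  assumes "finite S" "finite T"
  obtains l :: "nat \<Rightarrow> nat \<Rightarrow> 'a" where
    "\<And>x y. x \<in> S \<Longrightarrow> y \<in> T \<Longrightarrow>
       (\<Sum>k1<card S. \<Sum>k2<card T. l k1 k2 * x ^ k1 * y ^ k2) = a x y"
proof -
  obtain b where b: "\<And>u x. u \<in> S \<Longrightarrow> x \<in> S \<Longrightarrow>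
      (\<Sum>k<card S. b u k * x ^ k) = (if x = u then 1 else 0)"
    using lagrange_cardinal_coeffs[OF assms(1)] by blast
  obtain c where c: "\<And>v y. v \<in> T \<Longrightarrow> y \<in> T \<Longrightarrow>
      (\<Sum>k<card T. c v k * y ^ k) = (if y = v then 1 else 0)"
    using lagrange_cardinal_coeffs[OF assms(2)] by blast
  define l where "l k1 k2 = (\<Sum>u\<in>S. \<Sum>v\<in>T. a u v * b u k1 * c v k2)" for k1 k2
  have "(\<Sum>k1<card S. \<Sum>k2<card T. l k1 k2 * x ^ k1 * y ^ k2) = a x y"
    if x: "x \<in> S" and y: "y \<in> T" for x y
  proof -
    have "(\<Sum>k1<card S. \<Sum>k2<card T. l k1 k2 * x ^ k1 * y ^ k2) =
        (\<Sum>k1<card S. \<Sum>k2<card T. \<Sum>u\<in>S. \<Sum>v\<in>T.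
           a u v * ((b u k1 * x ^ k1) * (c v k2 * y ^ k2)))"
      by (simp add: l_def sum_distrib_left mult_ac)
    also have "\<dots> = (\<Sum>k1<card S. \<Sum>u\<in>S. \<Sum>k2<card T. \<Sum>v\<in>T.
           a u v * ((b u k1 * x ^ k1) * (c v k2 * y ^ k2)))"
      by (intro sum.cong refl sum.swap)
    also have "\<dots> = (\<Sum>u\<in>S. \<Sum>k1<card S. \<Sum>k2<card T. \<Sum>v\<in>T.
           a u v * ((b u k1 * x ^ k1) * (c v k2 * y ^ k2)))"
      by (rule sum.swap)
    also have "\<dots> = (\<Sum>u\<in>S. \<Sum>k1<card S. \<Sum>v\<in>T. \<Sum>k2<card T.
           a u v * ((b u k1 * x ^ k1) * (c v k2 * y ^ k2)))"
      by (intro sum.cong refl sum.swap)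
    also have "\<dots> = (\<Sum>u\<in>S. \<Sum>v\<in>T. \<Sum>k1<card S. \<Sum>k2<card T.
           a u v * ((b u k1 * x ^ k1) * (c v k2 * y ^ k2)))"
      by (intro sum.cong refl sum.swap)
    also have "\<dots> = (\<Sum>u\<in>S. \<Sum>v\<in>T. a u v *
           ((\<Sum>k1<card S. b u k1 * x ^ k1) * (\<Sum>k2<card T. c v k2 * y ^ k2)))"
      unfolding sum_product by (simp only: sum_distrib_left)
    also have "\<dots> = (\<Sum>u\<in>S. \<Sum>v\<in>T. a u v *
           ((if x = u then 1 else 0) * (if y = v then 1 else 0)))"
      by (intro sum.cong refl) (simp only: b c x y)
    also have "\<dots> = (\<Sum>u\<in>S. if x = u then a u y else 0)"
      using assms y by (intro sum.cong refl) (simp add: if_distrib cong: if_cong)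
    also have "\<dots> = a x y"
      using assms x by simp
    finally show ?thesis .
  qed
  then show ?thesis by (rule that)
qed

text \<open>
  The univariate statement applies first in \<open>x\<close>, with \<open>y \<in> T\<close> fixed, and then in \<open>y\<close>.
\<close>
lemma grid_values_zero_imp_coeffs_zero:
  fixes S T :: "'a::field set" and d :: "nat \<Rightarrow> nat \<Rightarrow> 'a"
  assumes zero: "\<And>x y. x \<in> S \<Longrightarrow> y \<in> T \<Longrightarrow>
      (\<Sum>k1<card S. \<Sum>k2<card T. d k1 k2 * x ^ k1 * y ^ k2) = 0"
    and k1: "k1 < card S" and k2: "k2 < card T"
  shows "d k1 k2 = 0"
proof -
  have "(\<Sum>k2<card T. d k1 k2 * y ^ k2) = 0" if y: "y \<in> T" for y
  proof (rule power_sum_zero_imp_coeffs_zero[OF _ k1])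
    fix x assume x: "x \<in> S"
    show "(\<Sum>k1<card S. (\<Sum>k2<card T. d k1 k2 * y ^ k2) * x ^ k1) = 0"
      using zero[OF x y] by (simp add: sum_distrib_left mult_ac)
  qed
  then show ?thesis
    by (rule power_sum_zero_imp_coeffs_zero[OF _ k2])
qed

theorem theorem3p1:
  fixes m n :: nat and a :: "nat \<Rightarrow> nat \<Rightarrow> real"
  assumes "m > 0" and "n > 0"
  shows "\<exists>!P. P \<in> poly_space m n \<and>
           (\<forall>i\<in>{1..m}. \<forall>j\<in>{1..n}. poly_xy P (real i) (real j) = a i j)"
proof (rule ex_ex1I)
  have card_nodes: "card (real ` {1..N}) = N" for N
    by (simp add: card_image)
  \<comment> \<open>The data are indexed by natural numbers, the grid by real nodes; \<open>x \<mapsto> nat \<lfloor>x\<rfloor>\<close> recovers the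
    index of a node.\<close>
  obtain l where l: "\<And>x y. x \<in> real ` {1..m} \<Longrightarrow> y \<in> real ` {1..n} \<Longrightarrow>
      (\<Sum>k1<m. \<Sum>k2<n. l k1 k2 * x ^ k1 * y ^ k2) = a (nat \<lfloor>x\<rfloor>) (nat \<lfloor>y\<rfloor>)"
    using grid_interpolation_exists[of "real ` {1..m}" "real ` {1..n}"
        "\<lambda>x y. a (nat \<lfloor>x\<rfloor>) (nat \<lfloor>y\<rfloor>)"]
    unfolding card_nodes by blast
  define P where "P = (\<Sum>k1<m. \<Sum>k2<n. monom (monom (l k1 k2) k2) k1)"
  have "P \<in> poly_space m n"
    unfolding poly_space_def P_def by blast
  moreover have "\<forall>i\<in>{1..m}. \<forall>j\<in>{1..n}. poly_xy P (real i) (real j) = a i j"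
    unfolding P_def poly_xy_sum_monom by (simp add: l)
  ultimately show "\<exists>P. P \<in> poly_space m n \<and>
      (\<forall>i\<in>{1..m}. \<forall>j\<in>{1..n}. poly_xy P (real i) (real j) = a i j)"
    by blast

  fix P Q
  assume P: "P \<in> poly_space m n \<and>
      (\<forall>i\<in>{1..m}. \<forall>j\<in>{1..n}. poly_xy P (real i) (real j) = a i j)"
    and Q: "Q \<in> poly_space m n \<and>
      (\<forall>i\<in>{1..m}. \<forall>j\<in>{1..n}. poly_xy Q (real i) (real j) = a i j)"
  obtain p where p: "P = (\<Sum>k1<m. \<Sum>k2<n. monom (monom (p k1 k2) k2) k1)"
    using P unfolding poly_space_def by blast
  obtain q where q: "Q = (\<Sum>k1<m. \<Sum>k2<n. monom (monom (q k1 k2) k2) k1)"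
    using Q unfolding poly_space_def by blast
  have "(\<Sum>k1<m. \<Sum>k2<n. (p k1 k2 - q k1 k2) * x ^ k1 * y ^ k2) = 0"
    if "x \<in> real ` {1..m}" "y \<in> real ` {1..n}" for x y
  proof -
    have "poly_xy P x y = poly_xy Q x y"
      using P Q that by auto
    then show ?thesis
      unfolding p q poly_xy_sum_monom by (simp add: left_diff_distrib sum_subtractf)
  qed
  then have "p k1 k2 - q k1 k2 = 0" if "k1 < m" "k2 < n" for k1 k2
    using grid_values_zero_imp_coeffs_zero[of "real ` {1..m}" "real ` {1..n}"
        "\<lambda>k1 k2. p k1 k2 - q k1 k2" k1 k2] that
    unfolding card_nodes by simp
  then show "P = Q"
    unfolding p q by (intro sum.cong refl) simp
qed

end
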